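(* Let $k>3$. Any self-similar group $(G,\mathsf{X}_k)$ that contains the automorphisms $a_{ij}$ and $a_{jl}$ for some $i,j,l\in\mathsf{X}_k$ all distinct is not contracting.
   Context: Let $\mathsf{X}$ be a finite alphabet and $\mathsf{X}^*$ the set of finite words over $\mathsf{X}$, viewed as a rooted tree; $\operatorname{Aut}\mathsf{X}^*$ is the group of permutations of $\mathsf{X}^*$ preserving word length and common prefixes. For $g\in\operatorname{Aut}\mathsf{X}^*$, the root permutation $\sigma_g\in\operatorname{Sym}(\mathsf{X})$ is the restriction of $g$ to one-letter words, and for $x\in\mathsf{X}$ the section $g|_x\in\operatorname{Aut}\mathsf{X}^*$ is defined by $g(xw)=\sigma_g(x)\,g|_x(w)$ for all $w\in\mathsf{X}^*$. For $w=x_n\ldots x_1$ set $g|_w=(g|_{x_n})|_{x_{n-1}\ldots x_1}$ inductively. A self-similar group $(G,\mathsf{X})$ is a subgroup $G\le\operatorname{Aut}\mathsf{X}^*$ with $g|_x\in G$ for all $g\in G$, $x\in\mathsf{X}$. It is contracting if there is a finite set $\mathcal{N}\subset G$ such that for every $g\in G$ there is $n\in\mathbb{N}$ with $g|_v\in\mathcal{N}$ for all words $v$ with $|v|\ge n$. Let $\mathsf{X}_k=\{0,\dots,k-1\}$. For distinct $i,j\in\mathsf{X}_k$, $a_{ij}=a_{ji}\in\operatorname{Aut}\mathsf{X}_k^*$ is the automorphism with root permutation the transposition $(i\ j)$ and sections $a_{ij}|_l=1$ for $l\in\{i,j\}$ and $a_{ij}|_l=a_{ij}$ for $l\notin\{i,j\}$.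 *)

theory Defs
  imports
    "HOL-Algebra.Bij"
    "HOL-Library.Sublist"
    "HOL-Combinatorics.Transposition"
begin

text \<open>
  The tree of words over an alphabet \<open>X\<close> is \<open>lists X\<close>. As in \<^theory>\<open>HOL-Algebra.Bij\<close>, its
  automorphisms are extensional functions, i.e. they are \<open>undefined\<close> outside \<open>lists X\<close>, so that
  equality of automorphisms is equality of functions on \<open>lists X\<close>.
\<close>

definition tree_aut :: "'a set \<Rightarrow> ('a list \<Rightarrow> 'a list) set" where
  "tree_aut X = {g \<in> Bij (lists X).
     (\<forall>u\<in>lists X. length (g u) = length u) \<and>
     (\<forall>u\<in>lists X. \<forall>v\<in>lists X.
        length (longest_common_prefix (g u) (g v)) = length (longest_common_prefix u v))}"

definition tree_aut_group :: "'a set \<Rightarrow> ('a list \<Rightarrow> 'a list) monoid" where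
  "tree_aut_group X = BijGroup (lists X)\<lparr>carrier := tree_aut X\<rparr>"

definition root_perm :: "'a set \<Rightarrow> ('a list \<Rightarrow> 'a list) \<Rightarrow> 'a \<Rightarrow> 'a" where
  "root_perm X g = (\<lambda>x\<in>X. hd (g [x]))"

text \<open>
  The defining equation \<open>g (x # w) = root_perm X g x # letter_section X g x w\<close> of the section is lemma
  \<open>tree_aut_Cons\<close> below.
\<close>

definition letter_section :: "'a set \<Rightarrow> ('a list \<Rightarrow> 'a list) \<Rightarrow> 'a \<Rightarrow> ('a list \<Rightarrow> 'a list)" where
  "letter_section X g x = (\<lambda>w\<in>lists X. tl (g (x # w)))"

primrec word_section :: "'a set \<Rightarrow> ('a list \<Rightarrow> 'a list) \<Rightarrow> 'a list \<Rightarrow> ('a list \<Rightarrow> 'a list)" where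
  "word_section X g [] = g"
| "word_section X g (x # v) = word_section X (letter_section X g x) v"

definition self_similar_group :: "'a set \<Rightarrow> ('a list \<Rightarrow> 'a list) set \<Rightarrow> bool" where
  "self_similar_group X G \<longleftrightarrow>
     subgroup G (tree_aut_group X) \<and> (\<forall>g\<in>G. \<forall>x\<in>X. letter_section X g x \<in> G)"

definition contracting :: "'a set \<Rightarrow> ('a list \<Rightarrow> 'a list) set \<Rightarrow> bool" where
  "contracting X G \<longleftrightarrow>
     (\<exists>N. finite N \<and> N \<subseteq> G \<and>
       (\<forall>g\<in>G. \<exists>n. \<forall>v\<in>lists X. length v \<ge> n \<longrightarrow> word_section X g v \<in> N))"

text \<open>
  The automorphism \<open>a\<^sub>i\<^sub>j\<close>, determined by its root permutation and its sections (lemmas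
  \<open>root_perm_a_aut\<close> and \<open>letter_section_a_aut\<close> below).
\<close>

primrec a_word :: "'a \<Rightarrow> 'a \<Rightarrow> 'a list \<Rightarrow> 'a list" where
  "a_word i j [] = []"
| "a_word i j (x # w) = transpose i j x # (if x \<in> {i, j} then w else a_word i j w)"

definition a_aut :: "'a set \<Rightarrow> 'a \<Rightarrow> 'a \<Rightarrow> ('a list \<Rightarrow> 'a list)" where
  "a_aut X i j = restrict (a_word i j) (lists X)"

lemma tree_autD:
  assumes "g \<in> tree_aut X"
  shows "g \<in> extensional (lists X)" "bij_betw g (lists X) (lists X)"
    "u \<in> lists X \<Longrightarrow> g u \<in> lists X"
    "u \<in> lists X \<Longrightarrow> length (g u) = length u"
    "u \<in> lists X \<Longrightarrow> v \<in> lists X \<Longrightarrow>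
      length (longest_common_prefix (g u) (g v)) = length (longest_common_prefix u v)"
  using assms by (auto simp: tree_aut_def Bij_def dest: bij_betwE)

lemma tree_aut_subgroup_BijGroup: "subgroup (tree_aut X) (BijGroup (lists X))"
proof -
  interpret B: group "BijGroup (lists X)" by (rule group_BijGroup)
  have sub: "tree_aut X \<subseteq> Bij (lists X)" by (auto simp: tree_aut_def)
  show ?thesis
  proof
    show "tree_aut X \<subseteq> carrier (BijGroup (lists X))"
      using sub by (simp add: BijGroup_def)
    show "\<one>\<^bsub>BijGroup (lists X)\<^esub> \<in> tree_aut X"
      using id_Bij[of "lists X"] by (simp add: BijGroup_def tree_aut_def)
    fix g assume g: "g \<in> tree_aut X"
    {
      fix h assume h: "h \<in> tree_aut X"
      have "compose (lists X) g h \<in> tree_aut X"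
        unfolding tree_aut_def
        using g h compose_Bij[of g "lists X" h] sub
        by (auto simp: compose_def tree_autD)
      then show "g \<otimes>\<^bsub>BijGroup (lists X)\<^esub> h \<in> tree_aut X"
        using g h sub by (simp add: BijGroup_def subset_iff)
    }
    define h where "h = restrict (inv_into (lists X) g) (lists X)"
    have gB: "g \<in> Bij (lists X)" using g sub by blast
    have hB: "h \<in> Bij (lists X)" unfolding h_def by (rule restrict_inv_into_Bij[OF gB])
    have gh: "g (h u) = u" "h u \<in> lists X" if "u \<in> lists X" for u
      using that tree_autD(2)[OF g] bij_betw_inv_into_right[of g "lists X" "lists X" u]
        Bij_inv_into_mem[OF gB that]
      by (simp_all add: h_def)
    have "h \<in> tree_aut X"
      unfolding tree_aut_def using hB
      tree_autD(4)[OF g gh(2)] tree_autD(5)[OF g gh(2) gh(2)] gh(1) by auto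
    moreover have "inv\<^bsub>BijGroup (lists X)\<^esub> g = h"
    proof (rule B.inv_equality)
      show "h \<otimes>\<^bsub>BijGroup (lists X)\<^esub> g = \<one>\<^bsub>BijGroup (lists X)\<^esub>"
        using Bij_compose_restrict_eq[OF gB] gB hB by (simp add: BijGroup_def h_def)
    qed (use gB hB in \<open>simp_all add: BijGroup_def\<close>)
    ultimately show "inv\<^bsub>BijGroup (lists X)\<^esub> g \<in> tree_aut X" by simp
  qed
qed

lemma group_tree_aut_group: "group (tree_aut_group X)"
  unfolding tree_aut_group_def
  by (rule subgroup.subgroup_is_group[OF tree_aut_subgroup_BijGroup group_BijGroup])

lemma tree_aut_single:
  assumes "g \<in> tree_aut X" "x \<in> X"
  shows "g [x] = [root_perm X g x]" "root_perm X g x \<in> X"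
proof -
  have "length (g [x]) = 1" "g [x] \<in> lists X"
    using tree_autD(3,4)[OF assms(1), of "[x]"] assms(2) by auto
  then show "g [x] = [root_perm X g x]" "root_perm X g x \<in> X"
    using assms(2) by (auto simp: root_perm_def length_Suc_conv)
qed

lemma tree_aut_Cons:
  assumes "g \<in> tree_aut X" "x \<in> X" "w \<in> lists X"
  shows "g (x # w) = root_perm X g x # letter_section X g x w"
proof -
  have "length (longest_common_prefix (g [x]) (g (x # w))) = 1"
    using tree_autD(5)[OF assms(1), of "[x]" "x # w"] assms by simp
  then have "hd (g (x # w)) = root_perm X g x \<and> g (x # w) \<noteq> []"
    by (cases "g (x # w)") (auto simp: tree_aut_single[OF assms(1,2)] split: if_splits)
  then show ?thesis
    using assms by (cases "g (x # w)") (auto simp: letter_section_def)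
qed

lemma root_perm_bij:
  assumes g: "g \<in> tree_aut X"
  shows "bij_betw (root_perm X g) X X"
proof -
  note b = tree_autD(2)[OF g]
  have "inj_on (root_perm X g) X"
  proof (rule inj_onI)
    fix x y assume xy: "x \<in> X" "y \<in> X" "root_perm X g x = root_perm X g y"
    then have "g [x] = g [y]" using tree_aut_single[OF g] by simp
    then show "x = y"
      using inj_onD[OF bij_betw_imp_inj_on[OF b], of "[x]" "[y]"] xy(1,2) by simp
  qed
  moreover have "y \<in> root_perm X g ` X" if y: "y \<in> X" for y
  proof -
    have "[y] \<in> g ` lists X"
      using b y by (simp add: bij_betw_def)
    then obtain u where u: "u \<in> lists X" "g u = [y]" by (metis imageE)
    then obtain x where "u = [x]" using tree_autD(4)[OF g, of u] by (cases u) auto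
    then show ?thesis using u tree_aut_single[OF g, of x] by auto
  qed
  ultimately show ?thesis
    using tree_aut_single(2)[OF g] by (auto simp: bij_betw_def)
qed

lemma letter_section_tree_aut:
  assumes g: "g \<in> tree_aut X" and x: "x \<in> X"
  shows "letter_section X g x \<in> tree_aut X"
proof -
  let ?h = "letter_section X g x"
  note b = tree_autD(2)[OF g]
  note c = tree_aut_Cons[OF g x]
  have mem: "?h w \<in> lists X" if "w \<in> lists X" for w
    using tree_autD(3)[OF g, of "x # w"] c[OF that] x that by simp
  have inj: "inj_on ?h (lists X)"
  proof (rule inj_onI)
    fix u v assume uv: "u \<in> lists X" "v \<in> lists X" "?h u = ?h v"
    then have "g (x # u) = g (x # v)" using c by simp
    then have "x # u = x # v"
      using inj_onD[OF bij_betw_imp_inj_on[OF b], of "x # u" "x # v"] uv(1,2) x by simp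
    then show "u = v" by simp
  qed
  have surj: "w \<in> ?h ` lists X" if w: "w \<in> lists X" for w
  proof -
    have "root_perm X g x # w \<in> g ` lists X"
      using b w tree_aut_single(2)[OF g x] by (simp add: bij_betw_def)
    then obtain v where v: "v \<in> lists X" "g v = root_perm X g x # w" by (metis imageE)
    then obtain y u where yu: "v = y # u" using tree_autD(4)[OF g, of v] by (cases v) auto
    then have "root_perm X g y = root_perm X g x" "letter_section X g y u = w"
      using v tree_aut_Cons[OF g, of y u] by auto
    moreover from this have "y = x"
      using inj_onD[OF bij_betw_imp_inj_on[OF root_perm_bij[OF g]], of y x] v(1) yu x by simp
    ultimately show ?thesis using v yu by auto
  qed
  have "?h \<in> Bij (lists X)"
  proof -
    have "?h ` lists X = lists X" using surj mem by blast
    then show ?thesis using inj by (simp add: Bij_def bij_betw_def) (simp add: letter_section_def)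
  qed
  moreover have "length (?h u) = length u" if "u \<in> lists X" for u
    using tree_autD(4)[OF g, of "x # u"] c[OF that] x that by simp
  moreover have "length (longest_common_prefix (?h u) (?h v)) = length (longest_common_prefix u v)"
    if "u \<in> lists X" "v \<in> lists X" for u v
    using tree_autD(5)[OF g, of "x # u" "x # v"] c that x by simp
  ultimately show ?thesis by (simp add: tree_aut_def)
qed

lemma a_word_lists: "i \<in> X \<Longrightarrow> j \<in> X \<Longrightarrow> w \<in> lists X \<Longrightarrow> a_word i j w \<in> lists X"
  by (induction w) (auto simp: transpose_def)

lemma a_word_invol: "a_word i j (a_word i j w) = w"
  by (induction w) (auto simp: transpose_def)

lemma a_word_lcp:
  "length (longest_common_prefix (a_word i j u) (a_word i j v)) = length (longest_common_prefix u v)"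
  by (induction u v rule: longest_common_prefix.induct) (auto simp: transpose_eq_iff)

lemma a_aut_tree_aut:
  assumes "i \<in> X" "j \<in> X"
  shows "a_aut X i j \<in> tree_aut X"
proof -
  have "bij_betw (a_word i j) (lists X) (lists X)"
    by (rule bij_betw_byWitness[where f' = "a_word i j"])
      (use a_word_lists[OF assms] in \<open>auto simp: a_word_invol\<close>)
  then have "a_aut X i j \<in> Bij (lists X)"
    unfolding a_aut_def Bij_def by (simp cong: bij_betw_cong)
  moreover have "length (a_word i j w) = length w" for w
    by (induction w) auto
  ultimately show ?thesis
    by (auto simp: tree_aut_def a_aut_def a_word_lcp)
qed

lemma root_perm_a_aut: "root_perm X (a_aut X i j) = restrict (transpose i j) X"
  by (auto simp: root_perm_def a_aut_def fun_eq_iff)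

lemma letter_section_a_aut:
  assumes "l \<in> X"
  shows "letter_section X (a_aut X i j) l =
    (if l \<in> {i, j} then \<one>\<^bsub>tree_aut_group X\<^esub> else a_aut X i j)"
  using assms
  by (auto simp: letter_section_def a_aut_def tree_aut_group_def BijGroup_def fun_eq_iff)

lemma a_aut_commute: "a_aut X i j = a_aut X j i"
proof -
  have "a_word i j w = a_word j i w" for w
    by (induction w) (auto simp: transpose_commute)
  then show ?thesis by (simp add: a_aut_def fun_eq_iff restrict_def)
qed

end

theory Submission
  imports Defs
begin

text \<open>
  Let \<open>a = a\<^sub>i\<^sub>j\<close>, \<open>b = a\<^sub>j\<^sub>l\<close> and \<open>g = ab\<close>. As \<open>k > 3\<close>, there is a letter \<open>m\<close> outside
  \<open>{i, j, l}\<close>. Both \<open>a\<close> and \<open>b\<close> fix \<open>m\<close> and are their own section there, so the same is true of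
  every power of \<open>g\<close>. An element that is its own section at some letter is its own section along
  arbitrarily long words, hence has to lie in the finite set that witnesses contraction
  (\<open>contracting_finite_self_sections\<close>). Thus a contracting group can contain only finitely many powers
  of \<open>g\<close>.

  On the other hand \<open>g\<close> has infinite order (\<open>a_prod_infinite_order\<close>). It permutes \<open>j, l, i\<close>
  cyclically, with sections \<open>a\<close>, \<open>1\<close>, \<open>b\<close>, so \<open>g\<^sup>3\<close> fixes \<open>j\<close> with section \<open>ba = g\<^sup>-\<^sup>1\<close>
  (\<open>a_prod_cube\<close>). If \<open>g\<^sup>n = 1\<close> then \<open>n\<close> is divisible by 3 and, passing to the section at \<open>j\<close>,
  \<open>g\<^bsup>n/3\<^esup> = 1\<close>; infinite descent gives \<open>n = 0\<close>.
\<close>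

lemma word_section_replicate:
  assumes "letter_section X g x = g"
  shows "word_section X g (replicate n x) = g"
  using assms by (induction n) auto

text \<open>
  An element \<open>g\<close> with \<open>g|\<^sub>x = g\<close> is its own section along \<open>x \<dots> x\<close>, a word of any length, so
  the finite set that absorbs all deep sections contains \<open>g\<close> itself.
\<close>

lemma contracting_finite_self_sections:
  assumes "contracting X G"
  shows "finite {g \<in> G. \<exists>x\<in>X. letter_section X g x = g}"
proof -
  obtain N where N: "finite N"
    "\<And>g. g \<in> G \<Longrightarrow> \<exists>n. \<forall>v\<in>lists X. length v \<ge> n \<longrightarrow> word_section X g v \<in> N"
    using assms unfolding contracting_def by blast
  have "g \<in> N" if g: "g \<in> G" "x \<in> X" "letter_section X g x = g" for g x
  proof -
    obtain n where n: "\<forall>v\<in>lists X. length v \<ge> n \<longrightarrow> word_section X g v \<in> N"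
      using N(2)[OF g(1)] by blast
    have "replicate n x \<in> lists X"
      using g(2) by (induction n) auto
    then show ?thesis
      using n[rule_format, of "replicate n x"] word_section_replicate[OF g(3), of n] by simp
  qed
  then show ?thesis
    using N(1) by (auto intro: finite_subset)
qed

lemma subgroup_restrict_closed:
  assumes "subgroup G (tree_aut_group X)"
  shows "restrict id (lists X) \<in> G"
    and "\<lbrakk>restrict f (lists X) \<in> G; restrict h (lists X) \<in> G; \<And>w. w \<in> lists X \<Longrightarrow> h w \<in> lists X\<rbrakk>
      \<Longrightarrow> restrict (f \<circ> h) (lists X) \<in> G"
proof -
  show "restrict id (lists X) \<in> G"
    using subgroup.one_closed[OF assms] by (simp add: tree_aut_group_def BijGroup_def id_def)
  assume f: "restrict f (lists X) \<in> G" and h: "restrict h (lists X) \<in> G"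
    and mem: "\<And>w. w \<in> lists X \<Longrightarrow> h w \<in> lists X"
  have sub: "G \<subseteq> Bij (lists X)"
    using subgroup.subset[OF assms] by (auto simp: tree_aut_group_def tree_aut_def)
  have "compose (lists X) (restrict f (lists X)) (restrict h (lists X)) \<in> G"
    using subgroup.m_closed[OF assms f h] f h sub
    by (simp add: tree_aut_group_def BijGroup_def subset_iff)
  moreover have "compose (lists X) (restrict f (lists X)) (restrict h (lists X))
      = restrict (f \<circ> h) (lists X)"
    using mem by (auto simp: compose_def fun_eq_iff)
  ultimately show "restrict (f \<circ> h) (lists X) \<in> G" by simp
qed

definition a_prod :: "'a \<Rightarrow> 'a \<Rightarrow> 'a \<Rightarrow> 'a list \<Rightarrow> 'a list" where
  "a_prod i j l = a_word i j \<circ> a_word j l"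

definition a_prod_inv :: "'a \<Rightarrow> 'a \<Rightarrow> 'a \<Rightarrow> 'a list \<Rightarrow> 'a list" where
  "a_prod_inv i j l = a_word j l \<circ> a_word i j"

lemma a_prod_funpow_inv: "(a_prod i j l ^^ n) ((a_prod_inv i j l ^^ n) w) = w"
proof (induction n arbitrary: w)
  case (Suc n)
  have "a_prod i j l (a_prod_inv i j l v) = v" for v
    by (simp add: a_prod_def a_prod_inv_def a_word_invol)
  then show ?case
    by (metis Suc.IH comp_apply funpow.simps(2) funpow_Suc_right)
qed simp

lemma a_prod_inj: "inj (a_prod i j l)"
  by (rule injI) (metis a_prod_def a_word_invol comp_apply)

lemma a_prod_funpow_lists:
  assumes "i \<in> X" "j \<in> X" "l \<in> X" "w \<in> lists X"
  shows "(a_prod i j l ^^ n) w \<in> lists X"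
proof (induction n)
  case (Suc n)
  then show ?case
    using a_word_lists[OF assms(1,2) a_word_lists[OF assms(2,3)]] by (simp add: a_prod_def)
qed (simp add: assms(4))

lemma a_prod_funpow_fixed:
  assumes "m \<notin> {i, j, l}"
  shows "(a_prod i j l ^^ n) (m # w) = m # (a_prod i j l ^^ n) w"
  using assms by (induction n) (auto simp: a_prod_def transpose_def)

text \<open>
  The orbit \<open>j \<mapsto> l \<mapsto> i \<mapsto> j\<close> collects the sections \<open>a\<^sub>i\<^sub>j\<close>, \<open>1\<close>, \<open>a\<^sub>j\<^sub>l\<close>, in this order, so their
  composite is the product of the two involutions in the reverse order.
\<close>

lemma a_prod_cube:
  assumes "distinct [i, j, l]"
  shows "(a_prod i j l ^^ 3) (j # w) = j # a_prod_inv i j l w"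
  using assms by (auto simp: a_prod_def a_prod_inv_def transpose_def numeral_3_eq_3)

lemma a_prod_funpow_mult_3:
  assumes "distinct [i, j, l]"
  shows "(a_prod i j l ^^ (3 * n)) (j # w) = j # (a_prod_inv i j l ^^ n) w"
proof -
  have "((a_prod i j l ^^ 3) ^^ n) (j # w) = j # (a_prod_inv i j l ^^ n) w"
    by (induction n) (simp_all add: a_prod_cube[OF assms])
  then show ?thesis by (simp add: funpow_mult mult.commute)
qed

lemma a_prod_period_dvd:
  assumes "distinct [i, j, l]" and "(a_prod i j l ^^ n) [j] = [j]"
  shows "3 dvd n"
proof -
  \<comment> \<open>The full turns fix the word \<open>[j]\<close>; the remaining one or two steps move it to \<open>[l]\<close> or \<open>[i]\<close>.\<close>
  have inv: "(a_prod_inv i j l ^^ q) [] = []" for q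
    by (induction q) (simp_all add: a_prod_inv_def)
  have "(a_prod i j l ^^ (n mod 3 + 3 * (n div 3))) [j] = (a_prod i j l ^^ (n mod 3)) [j]"
    by (simp only: funpow_add comp_apply a_prod_funpow_mult_3[OF assms(1)] inv)
  then have "(a_prod i j l ^^ (n mod 3)) [j] = [j]" using assms(2) by simp
  moreover have "n mod 3 = 0 \<or> n mod 3 = 1 \<or> n mod 3 = 2" by linarith
  ultimately show ?thesis
    using assms(1) by (auto simp: a_prod_def transpose_def numeral_2_eq_2 split: if_splits)
qed

text \<open>
  The descent: an exponent that kills the product is \<open>3q\<close> because the letter \<open>j\<close> has an orbit of
  length 3, and the action below \<open>j\<close> shows that \<open>q\<close> kills the inverse, hence the product itself.
\<close>

lemma a_prod_infinite_order:
  assumes "distinct [i, j, l]" and "j \<in> X"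
    and "\<And>w. w \<in> lists X \<Longrightarrow> (a_prod i j l ^^ n) w = w"
  shows "n = 0"
  using assms(3)
proof (induction n rule: less_induct)
  case (less n)
  obtain q where q: "n = 3 * q"
    using a_prod_period_dvd[OF assms(1)] less.prems[of "[j]"] assms(2) by auto
  have "(a_prod i j l ^^ q) w = w" if "w \<in> lists X" for w
  proof -
    have "(a_prod_inv i j l ^^ q) w = w"
      using less.prems[of "j # w"] a_prod_funpow_mult_3[OF assms(1), of q w] q assms(2) that by simp
    then show ?thesis
      using a_prod_funpow_inv[where w = w and n = q] by metis
  qed
  then show ?case using less.IH[of q] q by (cases "q = 0") auto
qed

theorem proposition3p3:
  fixes k :: nat and G :: "(nat list \<Rightarrow> nat list) set" and i j l :: nat
  assumes "k > 3"
    and "self_similar_group {0..<k} G"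
    and "i \<in> {0..<k}" and "j \<in> {0..<k}" and "l \<in> {0..<k}"
    and "i \<noteq> j" and "j \<noteq> l" and "i \<noteq> l"
    and "a_aut {0..<k} i j \<in> G" and "a_aut {0..<k} j l \<in> G"
  shows "\<not> contracting {0..<k} G"
proof
  let ?X = "{0..<k}"
  let ?p = "a_prod i j l"
  let ?g = "\<lambda>n. restrict (?p ^^ n) (lists ?X)"
  assume contr: "contracting ?X G"
  have sub: "subgroup G (tree_aut_group ?X)"
    using assms(2) by (simp add: self_similar_group_def)
  note mem = a_prod_funpow_lists[OF assms(3-5)]

  have "card {i, j, l} < card ?X"
    using assms(1) card_insert_le_m1[of 3 "{j, l}" i] by (simp add: card_insert_if)
  then obtain m where m: "m \<in> ?X" "m \<notin> {i, j, l}"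
    using card_mono[of "{i, j, l}" ?X] by (meson finite.intros not_le subsetI)

  have prod: "restrict ?p (lists ?X) \<in> G"
    unfolding a_prod_def
    by (rule subgroup_restrict_closed(2)[OF sub])
      (use assms(9,10) a_word_lists[OF assms(4,5)] in \<open>simp_all add: a_aut_def\<close>)
  have "?g n \<in> G" for n
  proof (induction n)
    case 0
    have "?p ^^ 0 = id" by auto
    then show ?case using subgroup_restrict_closed(1)[OF sub] by metis
  next
    case (Suc n)
    show ?case
      using subgroup_restrict_closed(2)[OF sub prod Suc mem] by (simp only: funpow.simps)
  qed
  moreover have "letter_section ?X (?g n) m = ?g n" for n
    using m by (auto simp: letter_section_def fun_eq_iff a_prod_funpow_fixed)
  ultimately have "range ?g \<subseteq> {g \<in> G. \<exists>x\<in>?X. letter_section ?X g x = g}"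
    using m(1) by blast
  then have "finite (range ?g)"
    using contracting_finite_self_sections[OF contr] finite_subset by blast
  moreover have "inj ?g"
  proof (rule linorder_injI)
    fix r s :: nat
    assume "r < s"
    show "?g r \<noteq> ?g s"
    proof
      assume eq: "?g r = ?g s"
      have "(?p ^^ (s - r)) w = w" if "w \<in> lists ?X" for w
      proof -
        have "(?p ^^ r) w = (?p ^^ (r + (s - r))) w"
          using fun_cong[OF eq, of w] that \<open>r < s\<close> by simp
        also have "\<dots> = (?p ^^ r) ((?p ^^ (s - r)) w)"
          by (simp only: funpow_add comp_apply)
        finally show ?thesis
          using injD[OF inj_fn[OF a_prod_inj]] by metis
      qed
      then show False
        using a_prod_infinite_order[of i j l ?X "s - r"] assms(4,6-8) \<open>r < s\<close> by simp
    qed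
  qed
  ultimately show False
    using finite_imageD infinite_UNIV_nat by blast
qed

end
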